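(* Let $L$ be an oriented link in $\mathbb{R}^3$ represented by a planar diagram $D$, and let $\overline\nu^{i,j}:\mathcal{H}_{\mathbb{Z}_2}^{i,j}(L)\to\mathcal{H}_{\mathbb{Z}_2}^{i,j+2}(L)$ be the differential of bidegree $(0,2)$ induced by $\nu$ on Khovanov homology over $\mathbb{Z}_2$. Then $\overline\nu$ is acyclic: for every fixed $i$ the sequence $$\cdots\xrightarrow{\overline\nu^{i,j-4}}\mathcal{H}_{\mathbb{Z}_2}^{i,j-2}(L)\xrightarrow{\overline\nu^{i,j-2}}\mathcal{H}_{\mathbb{Z}_2}^{i,j}(L)\xrightarrow{\overline\nu^{i,j}}\mathcal{H}_{\mathbb{Z}_2}^{i,j+2}(L)\xrightarrow{\overline\nu^{i,j+2}}\cdots$$ is exact. Consequently, $\sum_{j\in\mathbb{Z}}(-1)^jh_{\mathbb{Z}_2}^{i,2j+\gamma}(L)=0$ for every $i$, where $\gamma\in\{0,1\}$ is the number of components of $L$ modulo $2$ and $h_{\mathbb{Z}_2}^{i,j}(L)=\dim_{\mathbb{Z}_2}\mathcal{H}_{\mathbb{Z}_2}^{i,j}(L)$.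
   Context: Khovanov homology over $\mathbb{Z}_2$. Let $D$ be a planar diagram of an oriented link $L$, with writhe $w(D)$ (sum of the crossing signs). A (Kauffman) state $s$ of $D$ is a choice of a marker, positive or negative, at every crossing; the positive marker selects the two opposite quadrants swept when the overcrossing strand is rotated counterclockwise towards the undercrossing strand (so at a crossing of sign $+1$ the smoothing along the positive marker is the orientation-compatible one), the negative marker selects the other two. Smoothing every crossing along its marker (joining the two marked quadrants) gives a family $D_s$ of $|s|$ disjoint circles. Let $\sigma(s)$ be the number of positive minus the number of negative markers. An enhanced state $S$ is a state $s$ with a sign $+$ or $-$ on each circle of $D_s$; $\tau(S)$ is the number of $+$ circles minus the number of $-$ circles. Put $i(S)=\frac{w(D)-\sigma(s)}{2}$ and $j(S)=-\frac{\sigma(s)+2\tau(S)-3w(D)}{2}$. The chain group $\mathcal{C}^{i,j}(D;\mathbb{Z}_2)$ is the $\mathbb{Z}_2$-vector space on enhanced states with $i(S)=i$, $j(S)=j$. The differential $d:\mathcal{C}^{i,j}(D;\mathbb{Z}_2)\to\mathcal{C}^{i+1,j}(D;\mathbb{Z}_2)$ has matrix entries $(S_1:S_2)=1$ if: the markers of $S_1,S_2$ differ at exactly one crossing, where $S_1$ is positive and $S_2$ negative; the common circles have the same signs; and either two circles merge into one with signs $(-,-)\mapsto -$ or (different signs)$\mapsto +$, or one circle splits into two with signs $+\mapsto(+,+)$ or $-\mapsto$ (different signs); otherwise $(S_1:S_2)=0$. The homology is $\mathcal{H}_{\mathbb{Z}_2}^{i,j}(L)$. The map $\nu$. For an enhanced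 state $S$, let $\mathcal{N}(S)$ be the set of enhanced states with the same markers and the same signs on all circles as $S$ except for one circle, where $+$ is replaced by $-$. Define $\nu^{i,j}:\mathcal{C}^{i,j}(D;\mathbb{Z}_2)\to\mathcal{C}^{i,j+2}(D;\mathbb{Z}_2)$ by $\nu^{i,j}(S)=\sum_{S'\in\mathcal{N}(S)}S'$. Then $\nu^2=0$ and $\nu$ commutes with $d$, so $\nu$ induces $\overline\nu$ on homology. *)

theory Defs
  imports
    "Jordan_Normal_Form.VS_Connect"
    "HOL-Algebra.AbelCoset"
    "HOL-Library.Z2"
    "HOL-Library.Groups_Big_Fun"
begin

section \<open>Oriented planar link diagrams\<close>

text \<open>
  A diagram is given by its planar diagram code. The four ends of arcs at a crossing \<open>c\<close> are
  numbered \<open>0, 1, 2, 3\<close> counterclockwise, starting at the incoming end of the undercrossing strand,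
  and \<open>end_arc D c k\<close> is the arc that has the \<open>k\<close>-th end at \<open>c\<close>. Thus the undercrossing strand runs
  from \<open>0\<close> to \<open>2\<close>, and the overcrossing strand runs from \<open>3\<close> to \<open>1\<close> if the crossing is positive and
  from \<open>1\<close> to \<open>3\<close> if it is negative. An arc without ends is a component without crossings.
\<close>

record ('c, 'a) diagram =
  crossings :: "'c set"
  arcs :: "'a set"
  end_arc :: "'c \<Rightarrow> nat \<Rightarrow> 'a"
  positive :: "'c \<Rightarrow> bool"

definition in_ends :: "('c, 'a) diagram \<Rightarrow> ('c \<times> nat) set" where
  "in_ends D = {(c, k). c \<in> crossings D \<and> (k = 0 \<or> k = (if positive D c then 3 else 1))}"

definition out_ends :: "('c, 'a) diagram \<Rightarrow> ('c \<times> nat) set" where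
  "out_ends D = {(c, k). c \<in> crossings D \<and> (k = 2 \<or> k = (if positive D c then 1 else 3))}"

definition ends :: "('c, 'a) diagram \<Rightarrow> ('c \<times> nat) set" where
  "ends D = crossings D \<times> {..<4}"

definition eq_classes :: "'x set \<Rightarrow> ('x \<times> 'x) set \<Rightarrow> 'x set set" where
  "eq_classes A R = A // (R \<union> R\<inverse>)\<^sup>*"

text \<open>
  Faces are the orbits of ends under: follow the arc to its other end, then turn to the
  counterclockwise next end at the crossing reached.
\<close>

definition faces :: "('c, 'a) diagram \<Rightarrow> ('c \<times> nat) set set" where
  "faces D = eq_classes (ends D)
     {((c, k), (c', (k' + 1) mod 4)) | c k c' k'. (c, k) \<in> ends D \<and> (c', k') \<in> ends D \<and>
        (c, k) \<noteq> (c', k') \<and> end_arc D c k = end_arc D c' k'}"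

definition graph_components :: "('c, 'a) diagram \<Rightarrow> 'c set set" where
  "graph_components D = eq_classes (crossings D)
     {(c, c') | c k c' k'. (c, k) \<in> ends D \<and> (c', k') \<in> ends D \<and> end_arc D c k = end_arc D c' k'}"

text \<open>
  Planarity says that every connected component of the underlying 4-valent graph, with its cyclic
  orders at the crossings, has genus 0. As the Euler characteristic of each component is at most 2,
  this is one equation for their sum. How the components are nested in the plane is not recorded;
  no notion below depends on it.
\<close>

definition planar :: "('c, 'a) diagram \<Rightarrow> bool" where
  "planar D \<longleftrightarrow>
     int (card (crossings D)) - int (card ((\<lambda>(c, k). end_arc D c k) ` ends D)) + int (card (faces D))
       = 2 * int (card (graph_components D))"

text \<open>
  The third condition says that every arc with ends leaves exactly one crossing and enters exactly
  one crossing. A link has at least one component, so there is at least one arc.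
\<close>

definition planar_link_diagram :: "('c, 'a) diagram \<Rightarrow> bool" where
  "planar_link_diagram D \<longleftrightarrow>
     finite (crossings D) \<and> finite (arcs D) \<and> arcs D \<noteq> {} \<and>
     (\<lambda>(c, k). end_arc D c k) ` ends D \<subseteq> arcs D \<and>
     (\<forall>a \<in> (\<lambda>(c, k). end_arc D c k) ` ends D.
        (\<exists>!(c, k). (c, k) \<in> out_ends D \<and> end_arc D c k = a) \<and>
        (\<exists>!(c, k). (c, k) \<in> in_ends D \<and> end_arc D c k = a)) \<and>
     planar D"

definition link_components :: "('c, 'a) diagram \<Rightarrow> 'a set set" where
  "link_components D = eq_classes (arcs D)
     (\<Union>c \<in> crossings D. {(end_arc D c 0, end_arc D c 2), (end_arc D c 1, end_arc D c 3)})"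

definition writhe :: "('c, 'a) diagram \<Rightarrow> int" where
  "writhe D = (\<Sum>c \<in> crossings D. if positive D c then 1 else -1)"


section \<open>Enhanced states\<close>

text \<open>
  A state is the set \<open>P\<close> of crossings with positive marker. Rotating the overcrossing strand
  \<open>1\<close>--\<open>3\<close> counterclockwise sweeps the quadrants between the ends \<open>1, 2\<close> and between the ends
  \<open>3, 0\<close>; joining these two quadrants connects \<open>0\<close> with \<open>1\<close> and \<open>2\<close> with \<open>3\<close>. A circle of the
  smoothed diagram is represented by the set of arcs it runs through.
\<close>

definition circles :: "('c, 'a) diagram \<Rightarrow> 'c set \<Rightarrow> 'a set set" where
  "circles D P = eq_classes (arcs D)
     (\<Union>c \<in> crossings D.
        if c \<in> P then {(end_arc D c 0, end_arc D c 1), (end_arc D c 2, end_arc D c 3)}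
        else {(end_arc D c 1, end_arc D c 2), (end_arc D c 3, end_arc D c 0)})"

text \<open>An enhanced state is a pair \<open>(P, Q)\<close> of a state \<open>P\<close> and the set \<open>Q\<close> of its circles with sign \<open>+\<close>.\<close>

type_synonym ('c, 'a) enh_state = "'c set \<times> 'a set set"

definition enh_states :: "('c, 'a) diagram \<Rightarrow> ('c, 'a) enh_state set" where
  "enh_states D = {(P, Q). P \<subseteq> crossings D \<and> Q \<subseteq> circles D P}"

definition sigma :: "('c, 'a) diagram \<Rightarrow> ('c, 'a) enh_state \<Rightarrow> int" where
  "sigma D S = int (card (fst S)) - int (card (crossings D - fst S))"

definition tau :: "('c, 'a) diagram \<Rightarrow> ('c, 'a) enh_state \<Rightarrow> int" where
  "tau D S = int (card (snd S)) - int (card (circles D (fst S) - snd S))"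

text \<open>Both divisions are exact, since \<open>writhe D\<close> and \<open>sigma D S\<close> have the parity of the number of crossings.\<close>

definition i_deg :: "('c, 'a) diagram \<Rightarrow> ('c, 'a) enh_state \<Rightarrow> int" where
  "i_deg D S = (writhe D - sigma D S) div 2"

definition j_deg :: "('c, 'a) diagram \<Rightarrow> ('c, 'a) enh_state \<Rightarrow> int" where
  "j_deg D S = - ((sigma D S + 2 * tau D S - 3 * writhe D) div 2)"


section \<open>The chain complex\<close>

type_synonym ('c, 'a) chain = "('c, 'a) enh_state \<Rightarrow> bit"

definition chain_space :: "('c, 'a) diagram \<Rightarrow> int \<Rightarrow> int \<Rightarrow> (bit, ('c, 'a) chain) module" where
  "chain_space D i j =
     \<lparr>carrier = {x. \<forall>S. x S \<noteq> 0 \<longrightarrow> S \<in> enh_states D \<and> i_deg D S = i \<and> j_deg D S = j},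
      mult = undefined, one = undefined,
      zero = (\<lambda>S. 0), add = (\<lambda>x y S. x S + y S), smult = (\<lambda>a x S. a * x S)\<rparr>"

definition merge_signs :: "'a set set \<Rightarrow> 'a set set \<Rightarrow> 'a set set \<Rightarrow> 'a set set \<Rightarrow> bool" where
  "merge_signs K1 Q1 K2 Q2 \<longleftrightarrow>
     (\<exists>A B C. A \<noteq> B \<and> K1 - K2 = {A, B} \<and> K2 - K1 = {C} \<and>
        ((A \<notin> Q1 \<and> B \<notin> Q1 \<and> C \<notin> Q2) \<or> ((A \<in> Q1) \<noteq> (B \<in> Q1) \<and> C \<in> Q2)))"

definition split_signs :: "'a set set \<Rightarrow> 'a set set \<Rightarrow> 'a set set \<Rightarrow> 'a set set \<Rightarrow> bool" where
  "split_signs K1 Q1 K2 Q2 \<longleftrightarrow>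
     (\<exists>A B C. B \<noteq> C \<and> K1 - K2 = {A} \<and> K2 - K1 = {B, C} \<and>
        ((A \<in> Q1 \<and> B \<in> Q2 \<and> C \<in> Q2) \<or> (A \<notin> Q1 \<and> (B \<in> Q2) \<noteq> (C \<in> Q2))))"

fun incident :: "('c, 'a) diagram \<Rightarrow> ('c, 'a) enh_state \<Rightarrow> ('c, 'a) enh_state \<Rightarrow> bool" where
  "incident D (P1, Q1) (P2, Q2) \<longleftrightarrow>
     (P1, Q1) \<in> enh_states D \<and> (P2, Q2) \<in> enh_states D \<and>
     (\<exists>c \<in> P1. P2 = P1 - {c}) \<and>
     (\<forall>A \<in> circles D P1 \<inter> circles D P2. A \<in> Q1 \<longleftrightarrow> A \<in> Q2) \<and>
     (merge_signs (circles D P1) Q1 (circles D P2) Q2 \<or>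
      split_signs (circles D P1) Q1 (circles D P2) Q2)"

definition differential :: "('c, 'a) diagram \<Rightarrow> ('c, 'a) chain \<Rightarrow> ('c, 'a) chain" where
  "differential D x = (\<lambda>T. \<Sum>S \<in> enh_states D. x S * of_bool (incident D S T))"

fun lowerings :: "('c, 'a) enh_state \<Rightarrow> ('c, 'a) enh_state set" where
  "lowerings (P, Q) = {(P, Q - {A}) | A. A \<in> Q}"

definition nu :: "('c, 'a) diagram \<Rightarrow> ('c, 'a) chain \<Rightarrow> ('c, 'a) chain" where
  "nu D x = (\<lambda>T. \<Sum>S \<in> enh_states D. x S * of_bool (T \<in> lowerings S))"


section \<open>Homology\<close>

definition quotient_module :: "('k, 'v, 'e) module_scheme \<Rightarrow> 'v set \<Rightarrow> ('k, 'v set) module" where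
  "quotient_module M N =
     \<lparr>carrier = a_rcosets\<^bsub>M\<^esub> N, mult = undefined, one = undefined,
      zero = N, add = (\<lambda>X Y. X <+>\<^bsub>M\<^esub> Y),
      smult = (\<lambda>a X. \<Union>x \<in> X. N +>\<^bsub>M\<^esub> (a \<odot>\<^bsub>M\<^esub> x))\<rparr>"

definition cycles :: "('c, 'a) diagram \<Rightarrow> int \<Rightarrow> int \<Rightarrow> ('c, 'a) chain set" where
  "cycles D i j = {x \<in> carrier (chain_space D i j). differential D x = \<zero>\<^bsub>chain_space D (i + 1) j\<^esub>}"

definition boundaries :: "('c, 'a) diagram \<Rightarrow> int \<Rightarrow> int \<Rightarrow> ('c, 'a) chain set" where
  "boundaries D i j = differential D ` carrier (chain_space D (i - 1) j)"

definition homology :: "('c, 'a) diagram \<Rightarrow> int \<Rightarrow> int \<Rightarrow> (bit, ('c, 'a) chain set) module" where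
  "homology D i j =
     quotient_module ((chain_space D i j)\<lparr>carrier := cycles D i j\<rparr>) (boundaries D i j)"

definition nu_bar ::
  "('c, 'a) diagram \<Rightarrow> int \<Rightarrow> int \<Rightarrow> ('c, 'a) chain set \<Rightarrow> ('c, 'a) chain set" where
  "nu_bar D i j X =
     the_elem ((\<lambda>x. boundaries D i (j + 2) +>\<^bsub>chain_space D i (j + 2)\<^esub> nu D x) ` X)"

definition betti :: "('c, 'a) diagram \<Rightarrow> int \<Rightarrow> int \<Rightarrow> nat" where
  "betti D i j = vectorspace.dim class_ring (homology D i j)"

definition exact_at ::
  "('k, 'm) ring_scheme \<Rightarrow> ('k, 'u, 'p) module_scheme \<Rightarrow> ('u \<Rightarrow> 'v) \<Rightarrow> ('k, 'v, 'q) module_scheme \<Rightarrow>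
   ('v \<Rightarrow> 'w) \<Rightarrow> ('k, 'w, 'r) module_scheme \<Rightarrow> bool" where
  "exact_at K U f V g W \<longleftrightarrow>
     linear_map K U V f \<and> linear_map K V W g \<and> f ` carrier U = a_kernel V W g"

text \<open>
  For fixed \<open>i\<close> only finitely many \<open>betti D i j\<close> are nonzero, so that sums over all \<open>j\<close> are finite.
\<close>

lemma finite_enh_states:
  assumes "finite (crossings D)" and "finite (arcs D)"
  shows "finite (enh_states D)"
proof -
  have "finite (circles D P)" for P
    unfolding circles_def eq_classes_def quotient_def using assms by simp
  moreover have "enh_states D = (SIGMA P : Pow (crossings D). Pow (circles D P))"
    by (auto simp: enh_states_def)
  ultimately show ?thesis
    using assms by simp
qed

lemma betti_eq_0:
  assumes "\<And>S. S \<in> enh_states D \<Longrightarrow> j_deg D S \<noteq> j"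
  shows "betti D i j = 0"
proof -
  have C: "carrier (chain_space D i' j) = {\<lambda>S. 0}" for i'
  proof -
    have "x = (\<lambda>S. 0)" if "x \<in> carrier (chain_space D i' j)" for x
    proof
      show "x S = 0" for S
        using that assms[of S] by (cases S) (auto simp: chain_space_def simp del: bit_not_zero_iff)
    qed
    then show ?thesis
      by (auto simp: chain_space_def)
  qed
  have d: "differential D (\<lambda>S. 0) = (\<lambda>S. 0)"
    by (simp add: differential_def)
  have Z: "cycles D i j = {\<lambda>S. 0}"
    unfolding cycles_def C by (auto simp: d chain_space_def)
  have B: "boundaries D i j = {\<lambda>S. 0}"
    unfolding boundaries_def C by (simp add: d)
  let ?H = "homology D i j"
  have H: "carrier ?H = {{\<lambda>S. 0}}" "\<zero>\<^bsub>?H\<^esub> = {\<lambda>S. 0}"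
    "{\<lambda>S. 0} \<oplus>\<^bsub>?H\<^esub> {\<lambda>S. 0} = {\<lambda>S. 0}" "a \<odot>\<^bsub>?H\<^esub> {\<lambda>S. 0} = {\<lambda>S. 0}" for a
    unfolding homology_def quotient_module_def Z B
    by (auto simp: A_RCOSETS_def RCOSETS_def a_r_coset_def r_coset_def set_add_def set_mult_def
        chain_space_def)
  have cring: "cring (class_ring :: bit ring)"
    by (intro domain.axioms(1) field.axioms(1) class_field)
  have "abelian_group ?H"
    by (rule abelian_groupI) (auto simp: H)
  then have "module (class_ring :: bit ring) ?H"
    by (intro moduleI cring) (auto simp: H)
  then interpret vectorspace "class_ring :: bit ring" ?H
    by (intro vectorspace.intro class_field)
  have "gen_set {}"
    unfolding span_empty H ..
  then have "dim = 0"
    unfolding dim_def by (intro Least_eq_0) auto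
  then show ?thesis
    by (simp add: betti_def)
qed

lemma finite_betti_support:
  assumes "finite (crossings D)" and "finite (arcs D)"
  shows "finite {j. betti D i j \<noteq> 0}"
proof (rule finite_subset)
  show "{j. betti D i j \<noteq> 0} \<subseteq> j_deg D ` enh_states D"
  proof (intro subsetI, rule ccontr)
    fix j
    assume "j \<in> {j. betti D i j \<noteq> 0}" and "j \<notin> j_deg D ` enh_states D"
    moreover from this(2) have "betti D i j = 0"
      by (intro betti_eq_0) auto
    ultimately show False
      by simp
  qed
  show "finite (j_deg D ` enh_states D)"
    using finite_enh_states[OF assms] by simp
qed

end

theory Submission
  imports Defs
begin

text \<open>
  Over \<open>\<int>\<^sub>2\<close> the algebra of Khovanov homology is \<open>\<int>\<^sub>2[x]/x\<^sup>2\<close>, with \<open>-\<close> as \<open>1\<close> and \<open>+\<close> as \<open>x\<close>, and \<open>\<nu>\<close> is the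
  derivation \<open>d/dx\<close>. Fix an arc and let \<open>X\<close> multiply by \<open>x\<close> on the circle through it. Both \<open>\<nu>\<close> and \<open>X\<close>
  commute with the differential, which only depends on how circles partition the arcs, and \<open>\<nu> X + X \<nu> = 1\<close> by the product rule. So \<open>X\<close> induces a contracting
  homotopy for \<open>\<nu>\<close> on homology. The alternating sum of dimensions vanishes by rank-nullity.
\<close>

section \<open>Exactness from a contracting homotopy\<close>

text \<open>Negatives in \<open>N\<close> are multiples by the scalar -1. This opens the coset
  calculus of \<open>abelian_subgroup\<close> to submodules.\<close>

lemma (in Module.module) submodule_abelian_subgroup:
  assumes "submodule R N M"
  shows "abelian_subgroup N M"
proof -
  interpret N: submodule R N M
    by fact
  have "\<ominus>\<^bsub>M\<^esub> x \<in> N" if "x \<in> N" for x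
  proof -
    have "x \<in> carrier M"
      using that N.subset by auto
    from smult_minus_1[OF this] show ?thesis
      using that N.smult_closed[of "\<ominus>\<^bsub>R\<^esub> \<one>\<^bsub>R\<^esub>" x] by (metis R.a_inv_closed R.one_closed)
  qed
  then have "subgroup N (add_monoid M)"
    using N.subset N.zero_closed by (intro M.add.subgroupI) (auto simp flip: a_inv_def simp del: N.zero_closed)
  then show ?thesis
    by (intro abelian_subgroupI3 additive_subgroupI M.abelian_group_axioms)
qed

section \<open>Quotients of submodules of one ambient module\<close>

context Module.module
begin

context
  fixes N
  assumes N: "submodule R N M"
begin

interpretation N: submodule R N M
  by (rule N)

interpretation abelian_subgroup N M
  by (rule submodule_abelian_subgroup[OF N])

text \<open>Representatives of one coset differ by elements of \<open>N\<close>, and so do their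
  multiples by \<open>c\<close>. The union that defines scalar multiplication in
  \<open>quotient_module\<close> is therefore a union of equal sets.\<close>

lemma coset_smult:
  assumes "c \<in> carrier R" "x \<in> carrier M"
  shows "(\<Union>y \<in> N +>\<^bsub>M\<^esub> x. N +>\<^bsub>M\<^esub> (c \<odot>\<^bsub>M\<^esub> y)) = N +>\<^bsub>M\<^esub> (c \<odot>\<^bsub>M\<^esub> x)"
proof -
  have eq: "N +>\<^bsub>M\<^esub> (c \<odot>\<^bsub>M\<^esub> y) = N +>\<^bsub>M\<^esub> (c \<odot>\<^bsub>M\<^esub> x)" if "y \<in> N +>\<^bsub>M\<^esub> x" for y
  proof -
    from that obtain n where n: "n \<in> N" "y = n \<oplus>\<^bsub>M\<^esub> x"
      by (auto simp: a_r_coset_def')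
    then have "c \<odot>\<^bsub>M\<^esub> y = c \<odot>\<^bsub>M\<^esub> n \<oplus>\<^bsub>M\<^esub> c \<odot>\<^bsub>M\<^esub> x"
      using assms N.subset by (auto simp: smult_r_distr)
    then have "c \<odot>\<^bsub>M\<^esub> y \<in> N +>\<^bsub>M\<^esub> (c \<odot>\<^bsub>M\<^esub> x)"
      using n assms unfolding a_r_coset_def' by auto
    then show ?thesis
      using assms by (intro a_repr_independence'[symmetric]) auto
  qed
  have "N +>\<^bsub>M\<^esub> x \<noteq> {}"
    using a_rcos_self[OF assms(2)] by auto
  then show ?thesis
    using eq by (rule SUP_eq_const)
qed

text \<open>Cosets and their sums do not refer to the carrier, so restricting it to \<open>Z\<close>
  leaves them as in \<open>M\<close>. All later computations in quotients go through representatives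
  by these rules.\<close>

lemma quotient_module_ops:
  shows "carrier (quotient_module (M\<lparr>carrier := Z\<rparr>) N) = (\<lambda>x. N +>\<^bsub>M\<^esub> x) ` Z"
    and "\<zero>\<^bsub>quotient_module (M\<lparr>carrier := Z\<rparr>) N\<^esub> = N +>\<^bsub>M\<^esub> \<zero>\<^bsub>M\<^esub>"
    and "\<lbrakk>x \<in> carrier M; y \<in> carrier M\<rbrakk> \<Longrightarrow>
      (N +>\<^bsub>M\<^esub> x) \<oplus>\<^bsub>quotient_module (M\<lparr>carrier := Z\<rparr>) N\<^esub> (N +>\<^bsub>M\<^esub> y) = N +>\<^bsub>M\<^esub> (x \<oplus>\<^bsub>M\<^esub> y)"
    and "\<lbrakk>c \<in> carrier R; x \<in> carrier M\<rbrakk> \<Longrightarrow>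
      c \<odot>\<^bsub>quotient_module (M\<lparr>carrier := Z\<rparr>) N\<^esub> (N +>\<^bsub>M\<^esub> x) = N +>\<^bsub>M\<^esub> (c \<odot>\<^bsub>M\<^esub> x)"
proof -
  have ops: "N +>\<^bsub>M\<lparr>carrier := Z\<rparr>\<^esub> x = N +>\<^bsub>M\<^esub> x" "X <+>\<^bsub>M\<lparr>carrier := Z\<rparr>\<^esub> Y = X <+>\<^bsub>M\<^esub> Y" for x X Y
    by (simp_all add: a_r_coset_defs set_add_defs)
  show "carrier (quotient_module (M\<lparr>carrier := Z\<rparr>) N) = (\<lambda>x. N +>\<^bsub>M\<^esub> x) ` Z"
    by (auto simp: quotient_module_def A_RCOSETS_defs a_r_coset_defs)
  show "\<zero>\<^bsub>quotient_module (M\<lparr>carrier := Z\<rparr>) N\<^esub> = N +>\<^bsub>M\<^esub> \<zero>\<^bsub>M\<^esub>"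
    using a_coset_add_zero[OF N.subset] by (simp add: quotient_module_def)
  show "(N +>\<^bsub>M\<^esub> x) \<oplus>\<^bsub>quotient_module (M\<lparr>carrier := Z\<rparr>) N\<^esub> (N +>\<^bsub>M\<^esub> y) = N +>\<^bsub>M\<^esub> (x \<oplus>\<^bsub>M\<^esub> y)"
    if "x \<in> carrier M" "y \<in> carrier M"
    using that by (simp add: quotient_module_def ops a_rcos_sum)
  show "c \<odot>\<^bsub>quotient_module (M\<lparr>carrier := Z\<rparr>) N\<^esub> (N +>\<^bsub>M\<^esub> x) = N +>\<^bsub>M\<^esub> (c \<odot>\<^bsub>M\<^esub> x)"
    if "c \<in> carrier R" "x \<in> carrier M"
    using coset_smult[OF that] by (simp add: quotient_module_def ops)
qed

lemma module_quotient_module: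
  assumes "submodule R Z M"
  shows "module R (quotient_module (M\<lparr>carrier := Z\<rparr>) N)" (is "module R ?H")
proof -
  interpret Z: submodule R Z M
    by fact
  interpret Z: abelian_subgroup Z M
    by (rule submodule_abelian_subgroup[OF assms])
  have Z: "x \<in> carrier M" if "x \<in> Z" for x
    using that Z.subset by auto
  note ops = quotient_module_ops[where Z = Z]
  have obt: "\<exists>x \<in> Z. X = N +>\<^bsub>M\<^esub> x" if "X \<in> carrier ?H" for X
    using that unfolding ops by auto
  show ?thesis
  proof (intro moduleI abelian_groupI)
    show "cring R" ..
    show "\<zero>\<^bsub>?H\<^esub> \<in> carrier ?H"
      unfolding ops by auto
    fix X assume "X \<in> carrier ?H"
    then obtain x where x: "x \<in> Z" "X = N +>\<^bsub>M\<^esub> x"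
      using obt by auto
    show "\<zero>\<^bsub>?H\<^esub> \<oplus>\<^bsub>?H\<^esub> X = X"
      unfolding x(2) using x(1) Z by (simp add: ops)
    show "\<one>\<^bsub>R\<^esub> \<odot>\<^bsub>?H\<^esub> X = X"
      unfolding x(2) using x(1) Z by (simp add: ops)
    have "(N +>\<^bsub>M\<^esub> (\<ominus>\<^bsub>M\<^esub> x)) \<oplus>\<^bsub>?H\<^esub> X = \<zero>\<^bsub>?H\<^esub>"
      unfolding x(2) using x(1) Z by (simp add: ops M.l_neg)
    moreover have "N +>\<^bsub>M\<^esub> (\<ominus>\<^bsub>M\<^esub> x) \<in> carrier ?H"
      unfolding ops using x(1) by auto
    ultimately show "\<exists>Y \<in> carrier ?H. Y \<oplus>\<^bsub>?H\<^esub> X = \<zero>\<^bsub>?H\<^esub>"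
      by auto
    fix c assume c: "c \<in> carrier R"
    show "c \<odot>\<^bsub>?H\<^esub> X \<in> carrier ?H"
      unfolding x(2) using x(1) c Z by (simp add: ops)
    show "(c \<oplus>\<^bsub>R\<^esub> d) \<odot>\<^bsub>?H\<^esub> X = c \<odot>\<^bsub>?H\<^esub> X \<oplus>\<^bsub>?H\<^esub> d \<odot>\<^bsub>?H\<^esub> X"
      "(c \<otimes>\<^bsub>R\<^esub> d) \<odot>\<^bsub>?H\<^esub> X = c \<odot>\<^bsub>?H\<^esub> (d \<odot>\<^bsub>?H\<^esub> X)" if "d \<in> carrier R" for d
      unfolding x(2) using x(1) c that Z by (simp_all add: ops smult_l_distr smult_assoc1)
  next
    fix X Y assume "X \<in> carrier ?H" "Y \<in> carrier ?H"
    then obtain x y where x: "x \<in> Z" "X = N +>\<^bsub>M\<^esub> x" and y: "y \<in> Z" "Y = N +>\<^bsub>M\<^esub> y"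
      using obt by metis
    show "X \<oplus>\<^bsub>?H\<^esub> Y \<in> carrier ?H"
      unfolding x(2) y(2) using x(1) y(1) Z by (simp add: ops)
    show "X \<oplus>\<^bsub>?H\<^esub> Y = Y \<oplus>\<^bsub>?H\<^esub> X"
      unfolding x(2) y(2) using x(1) y(1) Z by (simp add: ops M.a_comm)
    show "c \<odot>\<^bsub>?H\<^esub> (X \<oplus>\<^bsub>?H\<^esub> Y) = c \<odot>\<^bsub>?H\<^esub> X \<oplus>\<^bsub>?H\<^esub> c \<odot>\<^bsub>?H\<^esub> Y" if "c \<in> carrier R" for c
      unfolding x(2) y(2) using x(1) y(1) that Z by (simp add: ops smult_r_distr)
    fix W assume "W \<in> carrier ?H"
    then obtain w where w: "w \<in> Z" "W = N +>\<^bsub>M\<^esub> w"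
      using obt by metis
    show "X \<oplus>\<^bsub>?H\<^esub> Y \<oplus>\<^bsub>?H\<^esub> W = X \<oplus>\<^bsub>?H\<^esub> (Y \<oplus>\<^bsub>?H\<^esub> W)"
      unfolding x(2) y(2) w(2) using x(1) y(1) w(1) Z by (simp add: ops M.a_assoc)
  qed
qed

lemma coset_eq_zero_coset_iff:
  assumes "x \<in> carrier M"
  shows "N +>\<^bsub>M\<^esub> x = N +>\<^bsub>M\<^esub> \<zero>\<^bsub>M\<^esub> \<longleftrightarrow> x \<in> N"
proof -
  have "N +>\<^bsub>M\<^esub> \<zero>\<^bsub>M\<^esub> = N"
    by (rule a_coset_add_zero[OF N.subset])
  then show ?thesis
    using assms a_rcos_self[OF assms] a_rcos_const[of x] by auto
qed

text \<open>Well-definedness of the induced map: \<open>f\<close> sends \<open>N\<close> into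
  \<open>N'\<close>, so all representatives of a coset give the same value and
  \<open>the_elem\<close> is applied to a singleton.\<close>

lemma the_elem_image_coset:
  assumes f: "f \<in> LinearCombinations.module_hom R M M" and N': "submodule R N' M" "f ` N \<subseteq> N'" and x: "x \<in> carrier M"
  shows "the_elem ((\<lambda>y. N' +>\<^bsub>M\<^esub> f y) ` (N +>\<^bsub>M\<^esub> x)) = N' +>\<^bsub>M\<^esub> f x"
proof -
  interpret N': abelian_subgroup N' M
    by (rule submodule_abelian_subgroup[OF N'(1)])
  have fx: "f x \<in> carrier M"
    using f x by (auto simp: LinearCombinations.module_hom_def)
  have eq: "N' +>\<^bsub>M\<^esub> f y = N' +>\<^bsub>M\<^esub> f x" if y: "y \<in> N +>\<^bsub>M\<^esub> x" for y
  proof -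
    from y obtain n where n: "n \<in> N" "y = n \<oplus>\<^bsub>M\<^esub> x"
      by (auto simp: a_r_coset_def')
    then have "f y = f n \<oplus>\<^bsub>M\<^esub> f x"
      using f x N.subset by (auto simp: LinearCombinations.module_hom_def)
    then have "f y \<in> N' +>\<^bsub>M\<^esub> f x"
      using n(1) N'(2) unfolding a_r_coset_def' by auto
    then show ?thesis
      using fx by (intro N'.a_repr_independence'[symmetric]) auto
  qed
  have "N +>\<^bsub>M\<^esub> x \<noteq> {}"
    using a_rcos_self[OF x] by auto
  then show ?thesis
    using eq by (rule the_elem_image_unique)
qed

end

lemma induced_module_hom:
  assumes f: "f \<in> LinearCombinations.module_hom R M M" "f ` N \<subseteq> N'" "f ` Z \<subseteq> Z'"
    and N: "submodule R N M" "submodule R N' M" and Z: "submodule R Z M" "submodule R Z' M"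
  shows "(\<lambda>X. the_elem ((\<lambda>y. N' +>\<^bsub>M\<^esub> f y) ` X)) \<in>
    LinearCombinations.module_hom R (quotient_module (M\<lparr>carrier := Z\<rparr>) N) (quotient_module (M\<lparr>carrier := Z'\<rparr>) N')"
    (is "?F \<in> LinearCombinations.module_hom R ?H ?H'")
proof -
  have ZM: "x \<in> carrier M" if "x \<in> Z" for x
    using that submodule.subset[OF Z(1)] by auto
  have fM: "f x \<in> carrier M" if "x \<in> carrier M" for x
    using that f(1) by (auto simp: LinearCombinations.module_hom_def)
  have F: "?F (N +>\<^bsub>M\<^esub> x) = N' +>\<^bsub>M\<^esub> f x" if "x \<in> carrier M" for x
    using the_elem_image_coset[OF N(1) f(1) N(2) f(2) that] .
  note ops = quotient_module_ops[OF N(1), where Z = Z] quotient_module_ops[OF N(2), where Z = Z']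
  have obt: "\<exists>x \<in> Z. X = N +>\<^bsub>M\<^esub> x" if "X \<in> carrier ?H" for X
    using that unfolding ops by auto
  show ?thesis
    unfolding LinearCombinations.module_hom_def
  proof (intro CollectI conjI allI impI funcsetI)
    fix X assume "X \<in> carrier ?H"
    then obtain x where x: "x \<in> Z" "X = N +>\<^bsub>M\<^esub> x"
      using obt by auto
    show "?F X \<in> carrier ?H'"
      unfolding x(2) F[OF ZM[OF x(1)]] ops using x f(3) by auto
  next
    fix X Y assume "X \<in> carrier ?H \<and> Y \<in> carrier ?H"
    then obtain x y where x: "x \<in> Z" "X = N +>\<^bsub>M\<^esub> x" and y: "y \<in> Z" "Y = N +>\<^bsub>M\<^esub> y"
      using obt by metis
    have "f (x \<oplus>\<^bsub>M\<^esub> y) = f x \<oplus>\<^bsub>M\<^esub> f y"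
      using f(1) x(1) y(1) ZM by (auto simp: LinearCombinations.module_hom_def)
    then show "?F (X \<oplus>\<^bsub>?H\<^esub> Y) = ?F X \<oplus>\<^bsub>?H'\<^esub> ?F Y"
      unfolding x(2) y(2) using x(1) y(1) ZM fM by (simp add: ops F)
  next
    fix c X assume cX: "c \<in> carrier R \<and> X \<in> carrier ?H"
    then obtain x where x: "x \<in> Z" "X = N +>\<^bsub>M\<^esub> x"
      using obt by metis
    have "f (c \<odot>\<^bsub>M\<^esub> x) = c \<odot>\<^bsub>M\<^esub> f x"
      using f(1) x(1) ZM cX by (auto simp: LinearCombinations.module_hom_def)
    then show "?F (c \<odot>\<^bsub>?H\<^esub> X) = c \<odot>\<^bsub>?H'\<^esub> ?F X"
      unfolding x(2) using x(1) ZM fM cX by (simp add: ops F)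
  qed
qed

text \<open>
  The submodules \<open>N\<close> need not be contained in the corresponding \<open>Z\<close>: the quotient is then the image
  of \<open>Z\<close> in \<open>M / N\<close>.
\<close>

lemma exact_at_quotient_modules:
  assumes field: "field R"
    and f: "f \<in> LinearCombinations.module_hom R M M"
    and N: "submodule R N0 M" "submodule R N1 M" "submodule R N2 M"
    and Z: "submodule R Z0 M" "submodule R Z1 M" "submodule R Z2 M"
    and fN: "f ` N0 \<subseteq> N1" "f ` N1 \<subseteq> N2" and fZ: "f ` Z0 \<subseteq> Z1" "f ` Z1 \<subseteq> Z2"
    and ff: "\<And>x. x \<in> Z0 \<Longrightarrow> f (f x) = \<zero>\<^bsub>M\<^esub>"
    and h: "h ` Z1 \<subseteq> Z0" "h ` N2 \<subseteq> N1"
    and homotopy: "\<And>x. x \<in> Z1 \<Longrightarrow> h (f x) \<oplus>\<^bsub>M\<^esub> f (h x) = x"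
  shows "exact_at R
    (quotient_module (M\<lparr>carrier := Z0\<rparr>) N0) (\<lambda>X. the_elem ((\<lambda>y. N1 +>\<^bsub>M\<^esub> f y) ` X))
    (quotient_module (M\<lparr>carrier := Z1\<rparr>) N1) (\<lambda>X. the_elem ((\<lambda>y. N2 +>\<^bsub>M\<^esub> f y) ` X))
    (quotient_module (M\<lparr>carrier := Z2\<rparr>) N2)"
    (is "exact_at R ?H0 ?f0 ?H1 ?f1 ?H2")
proof -
  have ZM: "x \<in> carrier M" if "x \<in> Z0 \<or> x \<in> Z1 \<or> x \<in> Z2" for x
    using that submodule.subset[OF Z(1)] submodule.subset[OF Z(2)] submodule.subset[OF Z(3)] by auto
  have vs: "vectorspace R ?H0" "vectorspace R ?H1" "vectorspace R ?H2"
    using field N Z by (auto intro!: vectorspace.intro module_quotient_module)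
  have F0: "?f0 (N0 +>\<^bsub>M\<^esub> x) = N1 +>\<^bsub>M\<^esub> f x" if "x \<in> Z0" for x
    using the_elem_image_coset[OF N(1) f N(2) fN(1)] ZM that by blast
  have F1: "?f1 (N1 +>\<^bsub>M\<^esub> x) = N2 +>\<^bsub>M\<^esub> f x" if "x \<in> Z1" for x
    using the_elem_image_coset[OF N(2) f N(3) fN(2)] ZM that by blast
  note ops = quotient_module_ops[OF N(1), where Z = Z0] quotient_module_ops[OF N(2), where Z = Z1]
    quotient_module_ops[OF N(3), where Z = Z2]
  have fM: "f x \<in> carrier M" if "x \<in> Z1" for x
    using that fZ(2) ZM by auto
  \<comment> \<open>The zero of the last quotient is the coset \<open>N2\<close>, so the class of
    \<open>x\<close> is killed exactly when \<open>f x\<close> lies in \<open>N2\<close>.\<close>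
  have ker: "a_kernel ?H1 ?H2 ?f1 = (\<lambda>x. N1 +>\<^bsub>M\<^esub> x) ` {x \<in> Z1. f x \<in> N2}"
    using F1 coset_eq_zero_coset_iff[OF N(3) fM] unfolding a_kernel_def' ops by auto
  have "?f0 ` carrier ?H0 = (\<lambda>x. N1 +>\<^bsub>M\<^esub> f x) ` Z0"
    unfolding ops image_image using F0 by (rule image_cong[OF refl])
  also have "\<dots> = (\<lambda>x. N1 +>\<^bsub>M\<^esub> x) ` {x \<in> Z1. f x \<in> N2}"
  proof (intro equalityI subsetI)
    fix X assume "X \<in> (\<lambda>x. N1 +>\<^bsub>M\<^esub> f x) ` Z0"
    then show "X \<in> (\<lambda>x. N1 +>\<^bsub>M\<^esub> x) ` {x \<in> Z1. f x \<in> N2}"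
      using fZ(1) ff submodule.zero_closed[OF N(3)] by auto
  next
    fix X assume "X \<in> (\<lambda>x. N1 +>\<^bsub>M\<^esub> x) ` {x \<in> Z1. f x \<in> N2}"
    then obtain x where x: "x \<in> Z1" "f x \<in> N2" "X = N1 +>\<^bsub>M\<^esub> x"
      by auto
    interpret N1: abelian_subgroup N1 M
      by (rule submodule_abelian_subgroup[OF N(2)])
    have hx: "h x \<in> Z0" "f (h x) \<in> carrier M"
      using x(1) h(1) fZ(1) ZM by blast+
    \<comment> \<open>For \<open>f x\<close> in \<open>N2\<close> the first term of the homotopy
      identity lies in \<open>N1\<close>, so \<open>x\<close> and \<open>f (h x)\<close> represent
      the same class and \<open>h x\<close> gives the preimage.\<close>
    have "x \<in> N1 +>\<^bsub>M\<^esub> f (h x)"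
    proof -
      have "h (f x) \<in> N1"
        using h(2) x(2) by auto
      then show ?thesis
        unfolding a_r_coset_def' using homotopy[OF x(1)] by (metis (lifting) UN_I singletonI)
    qed
    then have "X = N1 +>\<^bsub>M\<^esub> f (h x)"
      unfolding x(3) using hx(2) by (intro N1.a_repr_independence'[symmetric])
    then show "X \<in> (\<lambda>x. N1 +>\<^bsub>M\<^esub> f x) ` Z0"
      using hx(1) by auto
  qed
  finally have "?f0 ` carrier ?H0 = a_kernel ?H1 ?H2 ?f1"
    unfolding ker .
  moreover have "linear_map R ?H0 ?H1 ?f0" "linear_map R ?H1 ?H2 ?f1"
    using vs induced_module_hom[OF f fN(1) fZ(1) N(1,2) Z(1,2)]
      induced_module_hom[OF f fN(2) fZ(2) N(2,3) Z(2,3)]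
    by (auto simp: linear_map_def mod_hom_def mod_hom_axioms_def vectorspace_def)
  ultimately show ?thesis
    unfolding exact_at_def by simp
qed

end

section \<open>Alternating sums of dimensions in an exact sequence\<close>

lemma minus_one_power_nat_abs_succ: "(- 1 :: int) ^ nat \<bar>j + 1\<bar> = - ((- 1) ^ nat \<bar>j\<bar>)"
proof -
  have "even (nat \<bar>j + 1\<bar>) \<longleftrightarrow> odd (nat \<bar>j\<bar>)"
    by (simp add: even_nat_iff)
  then show ?thesis
    by (cases "even (nat \<bar>j\<bar>)") auto
qed

text \<open>Shifting the index by one reverses the sign, so the sums over \<open>r j\<close> and
  over \<open>r (j - 1)\<close> cancel. The finite support makes \<open>Sum_any\<close> additive
  here.\<close>

lemma Sum_any_alternating_telescope:
  fixes r :: "int \<Rightarrow> nat"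
  assumes "finite {j. r j \<noteq> 0}"
  shows "Sum_any (\<lambda>j :: int. (- 1) ^ nat \<bar>j\<bar> * int (r j + r (j - 1))) = 0"
proof -
  let ?g = "\<lambda>j. (- 1) ^ nat \<bar>j\<bar> * int (r j)" and ?g' = "\<lambda>j. (- 1) ^ nat \<bar>j\<bar> * int (r (j - 1))"
  have shift: "?g \<circ> (\<lambda>j. j - 1) = (\<lambda>j. - ?g' j)"
  proof
    fix j
    have "(- 1 :: int) ^ nat \<bar>j - 1\<bar> = - ((- 1) ^ nat \<bar>j\<bar>)"
      using minus_one_power_nat_abs_succ[of "j - 1"] by simp
    then show "(?g \<circ> (\<lambda>j. j - 1)) j = - ?g' j"
      by simp
  qed
  have bij: "bij (\<lambda>j :: int. j - 1)"
    by (rule bij_betw_byWitness[where f' = "\<lambda>j. j + 1"]) auto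
  have fin: "finite {j. ?g j \<noteq> 0}"
    using assms by simp
  have "{j. ?g' j \<noteq> 0} = (\<lambda>j. j + 1) ` {j. r j \<noteq> 0}"
    by (force simp: image_iff)
  then have fin': "finite {j. ?g' j \<noteq> 0}"
    using assms by simp
  have "Sum_any ?g = Sum_any (\<lambda>j. - ?g' j)"
    by (rule Sum_any.reindex_cong[OF bij shift])
  moreover have "Sum_any (\<lambda>j. - ?g' j) + Sum_any ?g' = 0"
    using fin' by (subst Sum_any.distrib[symmetric]) auto
  moreover have "Sum_any (\<lambda>j :: int. (- 1) ^ nat \<bar>j\<bar> * int (r j + r (j - 1))) = Sum_any ?g + Sum_any ?g'"
    using fin fin' by (subst Sum_any.distrib[symmetric]) (auto simp: algebra_simps)
  ultimately show ?thesis
    by simp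
qed

text \<open>The carrier is itself a finite generating set.\<close>

lemma (in vectorspace) finite_carrier_imp_fin_dim:
  assumes "finite (carrier V)"
  shows fin_dim
proof -
  have "span (carrier V) = carrier V"
    by (intro equalityI in_own_span span_is_subset2 order_refl)
  then show ?thesis
    unfolding fin_dim_def using assms by (intro exI[of _ "carrier V"]) simp
qed

text \<open>Rank-nullity for \<open>g\<close>, with its kernel replaced by the image of
  \<open>f\<close>. Both summands are ranks of maps, so neighbouring positions of a sequence share a
  summand.\<close>

lemma exact_at_dim:
  assumes "exact_at K U f V g W" "finite (carrier V)"
  shows "vectorspace.dim K V = vectorspace.dim K (W\<lparr>carrier := g ` carrier V\<rparr>) +
    vectorspace.dim K (V\<lparr>carrier := f ` carrier U\<rparr>)"
proof -
  interpret linear_map K V W g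
    using assms(1) by (simp add: exact_at_def)
  have "V.fin_dim"
    using assms(2) by (rule V.finite_carrier_imp_fin_dim)
  moreover have "kerT = f ` carrier U"
    using assms(1) by (auto simp: exact_at_def a_kernel_def' ker_def)
  ultimately show ?thesis
    using rank_nullity by (simp add: im_def)
qed

lemma alternating_sum_dim_exact_sequence:
  fixes V :: "int \<Rightarrow> ('k, 'v, 'e) module_scheme"
  assumes exact: "\<And>j. exact_at K (V (j - 1)) (f (j - 1)) (V j) (f j) (V (j + 1))"
    and fin: "\<And>j. finite (carrier (V j))"
    and supp: "finite {j. vectorspace.dim K (V j) \<noteq> 0}"
  shows "Sum_any (\<lambda>j. (- 1) ^ nat \<bar>j\<bar> * int (vectorspace.dim K (V j))) = 0"
proof -
  \<comment> \<open>\<open>r j\<close> is the rank of \<open>f j\<close>. Each dimension is the rank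
    of the outgoing map plus that of the incoming one, which is the form that telescopes.\<close>
  define r where "r j = vectorspace.dim K ((V (j + 1))\<lparr>carrier := f j ` carrier (V j)\<rparr>)" for j
  have dim: "vectorspace.dim K (V j) = r j + r (j - 1)" for j
    using exact_at_dim[OF exact fin, of j] by (simp add: r_def)
  have "finite {j. r j \<noteq> 0}"
    by (rule finite_subset[OF _ supp]) (auto simp: dim)
  then show ?thesis
    unfolding dim by (rule Sum_any_alternating_telescope)
qed

section \<open>Signs along an edge of the cube of states\<close>

text \<open>These rules rewrite field arithmetic on \<open>bit\<close> into propositional logic.\<close>

declare add_bit_eq_xor [simp del] mult_bit_eq_and [simp del]
  bit_not_zero_iff [simp del] bit_not_one_iff [simp del]

lemma bit_add_self [simp]: "(a :: bit) + a = 0" "a + (a + b) = b"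
  by (cases a; cases b; simp)+

text \<open>
  For a fixed state with set of circles \<open>K\<close>, chains are functions on subsets of \<open>K\<close>, i.e. elements of
  the tensor power of \<open>\<int>\<^sub>2[x]/x\<^sup>2\<close> indexed by \<open>K\<close>, where the sign \<open>-\<close> is \<open>1\<close> and the sign \<open>+\<close> is \<open>x\<close>. Then
  \<open>lower K\<close> is the derivation with \<open>x \<mapsto> 1\<close>, and \<open>raise k\<close> is multiplication by \<open>x\<close> in the factor \<open>k\<close>.
\<close>

definition edge_map ::
  "'a set set \<Rightarrow> 'a set set \<Rightarrow> ('a set set \<Rightarrow> bit) \<Rightarrow> 'a set set \<Rightarrow> bit" where
  "edge_map K1 K2 y Q = (\<Sum>Q1 \<in> Pow K1. y Q1 *
     of_bool ((\<forall>A \<in> K1 \<inter> K2. A \<in> Q1 \<longleftrightarrow> A \<in> Q) \<and>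
       (merge_signs K1 Q1 K2 Q \<or> split_signs K1 Q1 K2 Q)))"

definition lower :: "'b set \<Rightarrow> ('b set \<Rightarrow> bit) \<Rightarrow> 'b set \<Rightarrow> bit" where
  "lower K y Q = (\<Sum>A \<in> K - Q. y (insert A Q))"

definition raise :: "'b \<Rightarrow> ('b set \<Rightarrow> bit) \<Rightarrow> 'b set \<Rightarrow> bit" where
  "raise k y Q = (if k \<in> Q then y (Q - {k}) else 0)"

section \<open>Merging and splitting in coordinates\<close>

lemma sum_mult_of_bool:
  fixes f :: "'b \<Rightarrow> 'r :: semiring_1"
  assumes "finite A" and "{x \<in> A. P x} = B"
  shows "(\<Sum>x \<in> A. f x * of_bool (P x)) = sum f B"
proof -
  have "(\<Sum>x \<in> A. f x * of_bool (P x)) = (\<Sum>x \<in> A. if P x then f x else 0)"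
    by (rule sum.cong) auto
  then show ?thesis
    using assms sum.inter_filter[of A f P] by simp
qed

text \<open>The product on the factors \<open>A\<close> and \<open>B\<close>, read off coefficient
  by coefficient: 1 arises only as 1 * 1, and x arises as x * 1 and as 1 * x. \<open>L\<close> holds
  the common circles.\<close>

lemma edge_map_merge:
  assumes "finite L" "A \<noteq> B" "A \<notin> insert C L" "B \<notin> insert C L" "C \<notin> L" "R \<subseteq> L"
  shows "edge_map (insert A (insert B L)) (insert C L) y R = y R"
    and "edge_map (insert A (insert B L)) (insert C L) y (insert C R) = y (insert A R) + y (insert B R)"
proof -
  let ?K1 = "insert A (insert B L)" and ?K2 = "insert C L"
  have K: "?K1 - ?K2 = {A, B}" "?K2 - ?K1 = {C}" "?K1 \<inter> ?K2 = L"
    using assms by auto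
  have split: "\<not> split_signs ?K1 Q1 ?K2 Q" for Q1 Q
    unfolding split_signs_def K using assms by auto
  have merge: "merge_signs ?K1 Q1 ?K2 Q \<longleftrightarrow>
    (A \<notin> Q1 \<and> B \<notin> Q1 \<and> C \<notin> Q) \<or> ((A \<in> Q1) \<noteq> (B \<in> Q1) \<and> C \<in> Q)" for Q1 Q
    unfolding merge_signs_def K using assms(2) by (auto simp: doubleton_eq_iff)
  have "{Q1 \<in> Pow ?K1. (\<forall>X \<in> L. X \<in> Q1 \<longleftrightarrow> X \<in> R) \<and> merge_signs ?K1 Q1 ?K2 R} = {R}"
    using assms unfolding merge by blast
  then show "edge_map ?K1 ?K2 y R = y R"
    unfolding edge_map_def K using assms(1) by (subst sum_mult_of_bool) (auto simp: split)
  define F where "F = {Q1 \<in> Pow ?K1. (\<forall>X \<in> L. X \<in> Q1 \<longleftrightarrow> X \<in> insert C R) \<and>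
    merge_signs ?K1 Q1 ?K2 (insert C R)}"
  \<comment> \<open>The signs on \<open>L\<close> are prescribed and exactly one of \<open>A\<close>
    and \<open>B\<close> is positive, so the sign of \<open>A\<close> determines
    \<open>Q1\<close>.\<close>
  have *: "Q1 \<in> F \<longleftrightarrow> Q1 \<in> {insert A R, insert B R}" for Q1
  proof (cases "A \<in> Q1")
    case True
    then have "Q1 \<in> F \<longleftrightarrow> Q1 = insert A R"
      using assms unfolding F_def merge by auto
    moreover have "Q1 \<noteq> insert B R"
      using True assms by auto
    ultimately show ?thesis
      by simp
  next
    case False
    then have "Q1 \<in> F \<longleftrightarrow> Q1 = insert B R"
      using assms unfolding F_def merge by auto
    moreover have "Q1 \<noteq> insert A R"
      using False by auto
    ultimately show ?thesis
      by simp
  qed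
  have "F = {insert A R, insert B R}"
    by (intro Set.set_eqI *)
  moreover have "insert A R \<notin> {insert B R}"
    using assms by blast
  ultimately have "sum y F = y (insert A R) + y (insert B R)"
    by (simp only: sum.insert finite.intros) simp
  then show "edge_map ?K1 ?K2 y (insert C R) = y (insert A R) + y (insert B R)"
    unfolding edge_map_def K F_def using assms(1) by (subst sum_mult_of_bool) (simp_all add: split)
qed

text \<open>The coproduct 1 \<mapsto> 1 \<otimes> x + x \<otimes> 1, x \<mapsto> x \<otimes> x from
  the factor \<open>A\<close> to the factors \<open>B\<close> and \<open>C\<close>, again read off
  coefficient by coefficient.\<close>

lemma edge_map_split:
  assumes "finite L" "B \<noteq> C" "B \<notin> insert A L" "C \<notin> insert A L" "A \<notin> L" "R \<subseteq> L"
  shows "edge_map (insert A L) (insert B (insert C L)) y R = 0"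
    and "edge_map (insert A L) (insert B (insert C L)) y (insert B R) = y R"
    and "edge_map (insert A L) (insert B (insert C L)) y (insert C R) = y R"
    and "edge_map (insert A L) (insert B (insert C L)) y (insert B (insert C R)) = y (insert A R)"
proof -
  let ?K1 = "insert A L" and ?K2 = "insert B (insert C L)"
  have K: "?K1 - ?K2 = {A}" "?K2 - ?K1 = {B, C}" "?K1 \<inter> ?K2 = L"
    using assms by auto
  have merge: "\<not> merge_signs ?K1 Q1 ?K2 Q" for Q1 Q
    unfolding merge_signs_def K using assms by auto
  have split: "split_signs ?K1 Q1 ?K2 Q \<longleftrightarrow>
    (A \<in> Q1 \<and> B \<in> Q \<and> C \<in> Q) \<or> (A \<notin> Q1 \<and> (B \<in> Q) \<noteq> (C \<in> Q))" for Q1 Q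
    unfolding split_signs_def K using assms(2) by (auto simp: doubleton_eq_iff)
  have "edge_map ?K1 ?K2 y Q = sum y {Q1 \<in> Pow ?K1. (\<forall>X \<in> L. X \<in> Q1 \<longleftrightarrow> X \<in> Q) \<and>
      ((A \<in> Q1 \<and> B \<in> Q \<and> C \<in> Q) \<or> (A \<notin> Q1 \<and> (B \<in> Q) \<noteq> (C \<in> Q)))}" for Q
    unfolding edge_map_def K using assms(1) by (subst sum_mult_of_bool) (auto simp: merge split)
  \<comment> \<open>At most one source contributes to each target \<open>Q\<close>: the common
    circles keep their signs, and the signs of \<open>B\<close> and \<open>C\<close> determine that
    of \<open>A\<close>.\<close>
  moreover have "{Q1 \<in> Pow ?K1. (\<forall>X \<in> L. X \<in> Q1 \<longleftrightarrow> X \<in> Q) \<and>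
      ((A \<in> Q1 \<and> B \<in> Q \<and> C \<in> Q) \<or> (A \<notin> Q1 \<and> (B \<in> Q) \<noteq> (C \<in> Q)))} =
      (if B \<in> Q \<and> C \<in> Q then {insert A (Q \<inter> L)} else if B \<in> Q \<or> C \<in> Q then {Q \<inter> L} else {})" for Q
    using assms by (cases "B \<in> Q"; cases "C \<in> Q"; simp; blast)
  moreover have "insert B R \<inter> L = R" "insert C R \<inter> L = R" "insert B (insert C R) \<inter> L = R"
    "B \<notin> R" "C \<notin> R"
    using assms by auto
  ultimately show "edge_map ?K1 ?K2 y R = 0" "edge_map ?K1 ?K2 y (insert B R) = y R"
    "edge_map ?K1 ?K2 y (insert C R) = y R"
    "edge_map ?K1 ?K2 y (insert B (insert C R)) = y (insert A R)"
    using assms(2) by auto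
qed

text \<open>The sign rules mention only the two differences of \<open>K1\<close> and
  \<open>K2\<close>, whose sizes decide the case. For any other shape no sign rule can hold and
  every coefficient is zero.\<close>

lemma edge_map_cases [consumes 1, case_names merge split trivial]:
  assumes "finite K1"
  obtains A B C L where "K1 = insert A (insert B L)" "K2 = insert C L"
      "finite L" "A \<noteq> B" "A \<notin> insert C L" "B \<notin> insert C L" "C \<notin> L"
    | A B C L where "K1 = insert A L" "K2 = insert B (insert C L)"
      "finite L" "B \<noteq> C" "B \<notin> insert A L" "C \<notin> insert A L" "A \<notin> L"
    | "\<And>y Q. edge_map K1 K2 y Q = 0"
proof -
  show thesis
  proof (cases "\<exists>Q1 Q2. merge_signs K1 Q1 K2 Q2")
    case True
    then obtain A B C where *: "A \<noteq> B" "K1 - K2 = {A, B}" "K2 - K1 = {C}"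
      unfolding merge_signs_def by (elim exE conjE) rule
    show ?thesis
      by (rule that(1)[of A B "K1 \<inter> K2" C]) (use * assms in auto)
  next
    case no_merge: False
    show ?thesis
    proof (cases "\<exists>Q1 Q2. split_signs K1 Q1 K2 Q2")
      case True
      then obtain A B C where *: "B \<noteq> C" "K1 - K2 = {A}" "K2 - K1 = {B, C}"
        unfolding split_signs_def by (elim exE conjE) rule
      show ?thesis
        by (rule that(2)[of A "K1 \<inter> K2" B C]) (use * assms in auto)
    next
      case False
      with no_merge show ?thesis
        by (intro that(3)) (simp add: edge_map_def)
    qed
  qed
qed

section \<open>Compatibility of edge maps with \<open>lower\<close> and \<open>raise\<close>\<close>

lemma subset_insert_obtain:
  assumes "Q \<subseteq> insert C L"
  obtains R where "R \<subseteq> L" "Q = R \<or> Q = insert C R"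
  using that[of "Q - {C}"] assms by auto

lemma sum_insert_Diff:
  fixes g :: "'b \<Rightarrow> 'r :: comm_monoid_add"
  assumes "finite L" "A \<notin> L"
  shows "sum g (insert A L - R) = (if A \<in> R then 0 else g A) + sum g (L - R)"
  using assms by (simp add: insert_Diff_if)

text \<open>For a merge this is the product rule, where x * x = 0 agrees with 2x = 0. For a split, x
  \<otimes> x goes to 1 \<otimes> x + x \<otimes> 1, the coproduct of 1, while the derivative of the
  latter is twice 1 \<otimes> 1, hence zero.\<close>

lemma edge_map_lower:
  assumes "finite K1" "Q \<subseteq> K2"
  shows "edge_map K1 K2 (lower K1 y) Q = lower K2 (edge_map K1 K2 y) Q"
  using assms(1)
proof (cases rule: edge_map_cases[of K1 K2])
  case (merge A B C L)
  note em = edge_map_merge[OF merge(3-7)]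
  have [simp]: "A \<noteq> C" "B \<noteq> C" "A \<noteq> B" "C \<noteq> A" "C \<noteq> B" "B \<noteq> A"
    using merge by auto
  obtain R where R: "R \<subseteq> L" and Q: "Q = R \<or> Q = insert C R"
    using assms(2) merge(2) by (metis subset_insert_obtain)
  have [simp]: "A \<notin> R" "B \<notin> R" "C \<notin> R" "insert C L - insert C R = L - R"
    using merge R by auto
  \<comment> \<open>Summands of \<open>lower\<close> at a common circle \<open>X\<close> match one
    by one; only those at \<open>A\<close>, \<open>B\<close> and \<open>C\<close> then need
    comparison.\<close>
  have "edge_map K1 K2 y (insert X R) = y (insert X R)"
    "edge_map K1 K2 y (insert X (insert C R)) = y (insert X (insert A R)) + y (insert X (insert B R))"
    if "X \<in> L - R" for X
    using em[of "insert X R" y] that R merge(1,2) by (auto simp: insert_commute)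
  then show ?thesis
    using Q em[OF R] merge
    by (elim disjE) (simp_all add: lower_def sum_insert_Diff sum.distrib insert_commute add_ac)
next
  case (split A B C L)
  note em = edge_map_split[OF split(3-7)]
  have [simp]: "A \<noteq> C" "B \<noteq> C" "A \<noteq> B" "C \<noteq> A" "C \<noteq> B" "B \<noteq> A"
    using split by auto
  obtain R where R: "R \<subseteq> L"
    and Q: "Q = R \<or> Q = insert B R \<or> Q = insert C R \<or> Q = insert B (insert C R)"
    using assms(2) split(2) by (metis subset_insert_obtain)
  have [simp]: "A \<notin> R" "B \<notin> R" "C \<notin> R" "L - insert B R = L - R" "L - insert C R = L - R"
    "L - insert B (insert C R) = L - R"
    using split R by auto
  have "edge_map K1 K2 y (insert X R) = 0"
    "edge_map K1 K2 y (insert X (insert B R)) = y (insert X R)"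
    "edge_map K1 K2 y (insert X (insert C R)) = y (insert X R)"
    "edge_map K1 K2 y (insert X (insert B (insert C R))) = y (insert X (insert A R))"
    if "X \<in> L - R" for X
    using em[of "insert X R" y] that R split(1,2) by (auto simp: insert_commute)
  then show ?thesis
    using Q em[OF R] split
    by (elim disjE) (simp_all add: lower_def sum_insert_Diff sum.distrib insert_commute)
qed (simp add: lower_def)

text \<open>Product and coproduct are linear over multiplication by x in any factor involved. The
  last hypothesis says that the marked circle is either common to both sides or takes part in the
  change on both sides.\<close>

lemma edge_map_raise:
  assumes "finite K1" "Q \<subseteq> K2" "k1 \<in> K1" "k2 \<in> K2"
    and "k1 = k2 \<or> k1 \<notin> K2 \<and> k2 \<notin> K1"
  shows "edge_map K1 K2 (raise k1 y) Q = raise k2 (edge_map K1 K2 y) Q"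
  using assms(1)
proof (cases rule: edge_map_cases[of K1 K2])
  case (merge A B C L)
  note em = edge_map_merge[OF merge(3-7)]
  have [simp]: "A \<noteq> C" "B \<noteq> C" "A \<noteq> B" "C \<noteq> A" "C \<noteq> B" "B \<noteq> A"
    using merge by auto
  obtain R where R: "R \<subseteq> L" and Q: "Q = R \<or> Q = insert C R"
    using assms(2) merge(2) by (metis subset_insert_obtain)
  have [simp]: "A \<notin> R" "B \<notin> R" "C \<notin> R"
    using merge R by auto
  consider "k1 \<in> L" "k2 = k1" "k1 \<noteq> A" "k1 \<noteq> B" "k1 \<noteq> C" | "k1 = A" "k2 = C" | "k1 = B" "k2 = C"
    using assms(3-5) merge by auto
  moreover have "R - {k} \<subseteq> L" for k
    using R by auto
  ultimately show ?thesis
    using Q unfolding merge(1,2)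
    by cases (elim disjE; simp add: raise_def insert_Diff_if em R)+
next
  case (split A B C L)
  note em = edge_map_split[OF split(3-7)]
  have [simp]: "A \<noteq> C" "B \<noteq> C" "A \<noteq> B" "C \<noteq> A" "C \<noteq> B" "B \<noteq> A"
    using split by auto
  obtain R where R: "R \<subseteq> L"
    and Q: "Q = R \<or> Q = insert B R \<or> Q = insert C R \<or> Q = insert B (insert C R)"
    using assms(2) split(2) by (metis subset_insert_obtain)
  have [simp]: "A \<notin> R" "B \<notin> R" "C \<notin> R"
    using split R by auto
  consider "k1 \<in> L" "k2 = k1" "k1 \<noteq> A" "k1 \<noteq> B" "k1 \<noteq> C" | "k1 = A" "k2 = B" | "k1 = A" "k2 = C"
    using assms(3-5) split by auto
  moreover have "R - {k} \<subseteq> L" for k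
    using R by auto
  ultimately show ?thesis
    using Q unfolding split(1,2)
    by cases (elim disjE; simp add: raise_def insert_Diff_if em R)+
qed (simp add: raise_def)

section \<open>Identities between \<open>lower\<close> and \<open>raise\<close> at one state\<close>

lemma sum_symmetric_off_diagonal:
  fixes g :: "'b \<Rightarrow> 'b \<Rightarrow> bit"
  assumes "finite S" and "\<And>a b. g a b = g b a"
  shows "(\<Sum>a \<in> S. \<Sum>b \<in> S - {a}. g a b) = 0"
  using assms(1)
proof induction
  case (insert x S)
  have "(\<Sum>b \<in> insert x S - {a}. g a b) = g a x + (\<Sum>b \<in> S - {a}. g a b)" if "a \<in> S" for a
  proof -
    have "insert x S - {a} = insert x (S - {a})" "x \<notin> S - {a}"
      using insert.hyps that by auto
    then show ?thesis
      using insert.hyps by simp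
  qed
  moreover have "insert x S - {x} = S"
    using insert.hyps by auto
  ultimately show ?case
    using insert by (simp add: sum.distrib assms(2)[of x] add.assoc)
qed simp

text \<open>Two distinct circles are lowered in both orders, and the two contributions cancel modulo
  2.\<close>

lemma lower_lower:
  assumes "finite K"
  shows "lower K (lower K y) Q = 0"
proof -
  have "lower K (lower K y) Q = (\<Sum>A \<in> K - Q. \<Sum>B \<in> (K - Q) - {A}. y (insert B (insert A Q)))"
    unfolding lower_def by (intro sum.cong) auto
  also have "\<dots> = 0"
    using assms by (intro sum_symmetric_off_diagonal) (auto simp: insert_commute)
  finally show ?thesis .
qed

text \<open>The product rule for the derivative of x times \<open>y\<close> in the factor
  \<open>k\<close>, with signs dropped modulo 2.\<close>

lemma raise_lower:
  assumes "finite K" "k \<in> K" "Q \<subseteq> K"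
  shows "lower K (raise k y) Q + raise k (lower K y) Q = y Q"
proof (cases "k \<in> Q")
  case True
  \<comment> \<open>The second sum has the additional index \<open>k\<close>, whose term is
    \<open>y Q\<close>; all other terms occur in both sums.\<close>
  have "K - (Q - {k}) = insert k (K - Q)"
    using True assms by auto
  moreover have "insert A (Q - {k}) = insert A Q - {k}" if "A \<in> K - Q" for A
    using True that by auto
  ultimately show ?thesis
    using True assms by (auto simp: lower_def raise_def insert_absorb add_ac)
next
  case False
  have "(\<Sum>A \<in> K - Q. raise k y (insert A Q)) = (\<Sum>A \<in> K - Q. if A = k then y Q else 0)"
    using False by (intro sum.cong) (auto simp: raise_def)
  then show ?thesis
    using False assms by (simp add: lower_def raise_def)
qed

text \<open>This and the next two rules allow formulas that hold only on enhanced states to be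
  substituted under the operators.\<close>

lemma lower_cong:
  assumes "Q \<subseteq> K" "\<And>R. R \<subseteq> K \<Longrightarrow> y R = z R"
  shows "lower K y Q = lower K z Q"
  unfolding lower_def using assms by (intro sum.cong) auto

lemma raise_cong:
  assumes "Q \<subseteq> K" "\<And>R. R \<subseteq> K \<Longrightarrow> y R = z R"
  shows "raise k y Q = raise k z Q"
  unfolding raise_def using assms(1) assms(2)[of "Q - {k}"] by auto

lemma edge_map_cong:
  assumes "\<And>R. R \<subseteq> K1 \<Longrightarrow> y R = z R"
  shows "edge_map K1 K2 y Q = edge_map K1 K2 z Q"
  unfolding edge_map_def using assms by (intro sum.cong) auto

lemma lower_sum: "lower K (\<lambda>R. \<Sum>c \<in> C. y c R) Q = (\<Sum>c \<in> C. lower K (y c) Q)"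
  unfolding lower_def by (rule sum.swap)

lemma raise_sum: "raise k (\<lambda>R. \<Sum>c \<in> C. y c R) Q = (\<Sum>c \<in> C. raise k (y c) Q)"
  by (simp add: raise_def)

section \<open>Multiplication at a base point\<close>

definition base_circle :: "('c, 'a) diagram \<Rightarrow> 'a \<Rightarrow> 'c set \<Rightarrow> 'a set" where
  "base_circle D a P = (THE A. A \<in> circles D P \<and> a \<in> A)"

text \<open>The relation \<open>(R \<union> R\<inverse>)\<^sup>*\<close> is an equivalence on the
  whole type, so its classes are disjoint or equal.\<close>

lemma eq_classes_unique:
  assumes "X \<in> eq_classes A R" "Y \<in> eq_classes A R" "x \<in> X" "x \<in> Y"
  shows "X = Y"
proof -
  let ?r = "(R \<union> R\<inverse>)\<^sup>*"
  have "equiv UNIV ?r"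
    by (intro equivI refl_rtrancl sym_rtrancl trans_rtrancl sym_Un_converse subset_UNIV) simp
  moreover have "X \<in> UNIV // ?r" "Y \<in> UNIV // ?r"
    using assms(1,2) unfolding eq_classes_def quotient_def by auto
  ultimately show ?thesis
    using assms(3,4) by (metis disjoint_iff quotient_disj)
qed

lemma eq_classes_cover:
  assumes "x \<in> A"
  shows "\<exists>X. X \<in> eq_classes A R \<and> x \<in> X"
  unfolding eq_classes_def
  by (intro exI[of _ "(R \<union> R\<inverse>)\<^sup>* `` {x}"] conjI quotientI assms) auto

lemma base_circle:
  assumes "a \<in> arcs D"
  shows "base_circle D a P \<in> circles D P" "a \<in> base_circle D a P"
    and "A \<in> circles D P \<Longrightarrow> a \<in> A \<Longrightarrow> A = base_circle D a P"
proof -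
  have "\<exists>!A. A \<in> circles D P \<and> a \<in> A"
    unfolding circles_def
    by (rule ex_ex1I[OF eq_classes_cover[OF assms]], elim conjE) (rule eq_classes_unique)
  then have *: "base_circle D a P \<in> circles D P \<and> a \<in> base_circle D a P"
    unfolding base_circle_def by (rule theI')
  then show "base_circle D a P \<in> circles D P" "a \<in> base_circle D a P"
    by simp_all
  show "A = base_circle D a P" if "A \<in> circles D P" "a \<in> A"
    using that * unfolding circles_def by (elim conjE) (rule eq_classes_unique)
qed

text \<open>Multiplication by x at a fixed arc; the circle that carries it changes with the state.
  The value 0 elsewhere keeps the result supported on enhanced states.\<close>

definition point_mult :: "('c, 'a) diagram \<Rightarrow> 'a \<Rightarrow> ('c, 'a) chain \<Rightarrow> ('c, 'a) chain" where
  "point_mult D a x = (\<lambda>(P, Q). if (P, Q) \<in> enh_states D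
     then raise (base_circle D a P) (\<lambda>R. x (P, R)) Q else 0)"

lemma finite_circles:
  assumes "finite (arcs D)"
  shows "finite (circles D P)"
  unfolding circles_def eq_classes_def quotient_def using assms by simp

section \<open>Operators on chains, computed state by state\<close>

locale finite_diagram =
  fixes D :: "('c, 'a) diagram"
  assumes finite_crossings: "finite (crossings D)" and finite_arcs: "finite (arcs D)"
begin

lemma enh_states_Sigma: "enh_states D = (SIGMA P : Pow (crossings D). Pow (circles D P))"
  by (auto simp: enh_states_def)

lemma sum_enh_states:
  "(\<Sum>S \<in> enh_states D. g S) = (\<Sum>P \<in> Pow (crossings D). \<Sum>Q \<in> Pow (circles D P). g (P, Q))"
  unfolding enh_states_Sigma
  by (subst sum.Sigma) (auto simp: finite_crossings finite_circles[OF finite_arcs])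

text \<open>The differential seen from its target: a state \<open>P\<close> receives contributions
  from the states with one further positive marker, each through an edge map.\<close>

lemma differential_eq:
  "differential D x (P, Q) = (if (P, Q) \<in> enh_states D
     then \<Sum>c \<in> crossings D - P.
       edge_map (circles D (insert c P)) (circles D P) (\<lambda>R. x (insert c P, R)) Q
     else 0)"
proof (cases "(P, Q) \<in> enh_states D")
  case True
  then have PQ: "P \<subseteq> crossings D" "Q \<subseteq> circles D P"
    by (auto simp: enh_states_def)
  define g where "g P1 = edge_map (circles D P1) (circles D P) (\<lambda>R. x (P1, R)) Q" for P1
  have "differential D x (P, Q) = (\<Sum>P1 \<in> Pow (crossings D). \<Sum>Q1 \<in> Pow (circles D P1).
      x (P1, Q1) * of_bool (incident D (P1, Q1) (P, Q)))"
    unfolding differential_def sum_enh_states ..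
  also have "\<dots> = (\<Sum>P1 \<in> Pow (crossings D). if \<exists>c \<in> P1. P = P1 - {c} then g P1 else 0)"
  proof (intro sum.cong refl)
    fix P1 assume "P1 \<in> Pow (crossings D)"
    then show "(\<Sum>Q1 \<in> Pow (circles D P1). x (P1, Q1) * of_bool (incident D (P1, Q1) (P, Q)))
        = (if \<exists>c \<in> P1. P = P1 - {c} then g P1 else 0)"
      using PQ unfolding g_def edge_map_def
      by (auto intro!: sum.cong sum.neutral arg_cong2[where f = times] simp: enh_states_def)
  qed
  also have "\<dots> = sum g {P1 \<in> Pow (crossings D). \<exists>c \<in> P1. P = P1 - {c}}"
    using finite_crossings by (intro sum.inter_filter[symmetric]) simp
  also have "{P1 \<in> Pow (crossings D). \<exists>c \<in> P1. P = P1 - {c}} = (\<lambda>c. insert c P) ` (crossings D - P)"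
    using PQ(1) by (auto simp: image_iff)
  also have "sum g \<dots> = (\<Sum>c \<in> crossings D - P. g (insert c P))"
    by (subst sum.reindex) (auto intro!: inj_onI)
  finally show ?thesis
    using True by (simp add: g_def)
next
  case False
  then have "incident D S (P, Q) \<longleftrightarrow> False" for S
    by (cases S) auto
  then show ?thesis
    using False by (simp add: differential_def)
qed

lemma nu_eq:
  "nu D x (P, Q) = (if (P, Q) \<in> enh_states D then lower (circles D P) (\<lambda>R. x (P, R)) Q else 0)"
proof (cases "(P, Q) \<in> enh_states D")
  case True
  \<comment> \<open>The preimages of \<open>(P, Q)\<close> under lowering restore the sign + on one
    of its negative circles.\<close>
  have "{S \<in> enh_states D. (P, Q) \<in> lowerings S} = (\<lambda>A. (P, insert A Q)) ` (circles D P - Q)"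
  proof (intro Set.set_eqI iffI)
    fix S assume "S \<in> {S \<in> enh_states D. (P, Q) \<in> lowerings S}"
    then obtain A R where "S = (P, R)" "A \<in> R" "Q = R - {A}" "R \<subseteq> circles D P"
      by (cases S) (auto simp: enh_states_def)
    then show "S \<in> (\<lambda>A. (P, insert A Q)) ` (circles D P - Q)"
      by (auto simp: image_iff insert_absorb)
  next
    fix S assume "S \<in> (\<lambda>A. (P, insert A Q)) ` (circles D P - Q)"
    then show "S \<in> {S \<in> enh_states D. (P, Q) \<in> lowerings S}"
      using True by (auto simp: enh_states_def)
  qed
  then have "nu D x (P, Q) = (\<Sum>S \<in> (\<lambda>A. (P, insert A Q)) ` (circles D P - Q). x S)"
    unfolding nu_def by (intro sum_mult_of_bool finite_enh_states finite_crossings finite_arcs)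
  also have "\<dots> = lower (circles D P) (\<lambda>R. x (P, R)) Q"
    unfolding lower_def by (subst sum.reindex) (auto intro!: inj_onI)
  finally show ?thesis
    using True by simp
next
  case False
  then have "(P, Q) \<notin> lowerings S" if "S \<in> enh_states D" for S
    using that by (cases S) (auto simp: enh_states_def)
  then show ?thesis
    using False by (simp add: nu_def)
qed

lemma point_mult_eq:
  "point_mult D a x (P, Q) =
    (if (P, Q) \<in> enh_states D then raise (base_circle D a P) (\<lambda>R. x (P, R)) Q else 0)"
  by (simp add: point_mult_def)

lemma nu_nu: "nu D (nu D x) = (\<lambda>S. 0)"
proof
  fix S show "nu D (nu D x) S = 0"
  proof (cases S)
    case (Pair P Q)
    have "lower (circles D P) (\<lambda>R. nu D x (P, R)) Q
        = lower (circles D P) (lower (circles D P) (\<lambda>R. x (P, R))) Q" if "(P, Q) \<in> enh_states D"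
      using that by (intro lower_cong) (auto simp: nu_eq enh_states_def)
    then show ?thesis
      by (simp add: Pair nu_eq[of _ P Q] lower_lower finite_circles finite_arcs)
  qed
qed

text \<open>The contracting homotopy on chains, by \<open>raise_lower\<close> at each state. Both
  operators give 0 off the enhanced states, where \<open>x\<close> is assumed to vanish too.\<close>

lemma nu_point_mult:
  assumes "a \<in> arcs D" "\<And>S. S \<notin> enh_states D \<Longrightarrow> x S = 0"
  shows "nu D (point_mult D a x) S + point_mult D a (nu D x) S = x S"
proof (cases S)
  case (Pair P Q)
  show ?thesis
  proof (cases "(P, Q) \<in> enh_states D")
    case True
    let ?K = "circles D P" and ?k = "base_circle D a P"
    have Q: "Q \<subseteq> ?K"
      using True by (auto simp: enh_states_def)
    have "lower ?K (\<lambda>R. point_mult D a x (P, R)) Q = lower ?K (raise ?k (\<lambda>R. x (P, R))) Q"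
      using True Q by (intro lower_cong) (auto simp: point_mult_eq enh_states_def)
    moreover have "raise ?k (\<lambda>R. nu D x (P, R)) Q = raise ?k (lower ?K (\<lambda>R. x (P, R))) Q"
      using True Q by (intro raise_cong) (auto simp: nu_eq enh_states_def)
    ultimately show ?thesis
      using True raise_lower[OF _ base_circle(1)[OF assms(1)] Q]
      by (simp add: Pair nu_eq[of _ P Q] point_mult_eq[of _ _ P Q] finite_circles finite_arcs)
  next
    case False
    then show ?thesis
      by (simp add: Pair nu_eq point_mult_eq assms(2))
  qed
qed

text \<open>Apply \<open>edge_map_lower\<close> on each edge that ends at the state, then use
  additivity of \<open>lower\<close>.\<close>

lemma differential_nu: "differential D (nu D x) = nu D (differential D x)"
proof
  fix S show "differential D (nu D x) S = nu D (differential D x) S"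
  proof (cases S)
    case (Pair P Q)
    show ?thesis
    proof (cases "(P, Q) \<in> enh_states D")
      case True
      let ?K = "circles D P" and ?K' = "\<lambda>c. circles D (insert c P)"
      have PQ: "P \<subseteq> crossings D" "Q \<subseteq> ?K"
        using True by (auto simp: enh_states_def)
      have "differential D (nu D x) (P, Q) = (\<Sum>c \<in> crossings D - P.
          edge_map (?K' c) ?K (lower (?K' c) (\<lambda>R. x (insert c P, R))) Q)"
        using PQ True by (auto simp: differential_eq nu_eq enh_states_def intro!: sum.cong edge_map_cong)
      also have "\<dots> = (\<Sum>c \<in> crossings D - P.
          lower ?K (edge_map (?K' c) ?K (\<lambda>R. x (insert c P, R))) Q)"
        using PQ by (intro sum.cong refl edge_map_lower finite_circles finite_arcs)
      also have "\<dots> = lower ?K (\<lambda>R. differential D x (P, R)) Q"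
        using PQ unfolding lower_sum[symmetric]
        by (intro lower_cong) (auto simp: differential_eq enh_states_def)
      finally show ?thesis
        using True by (simp add: Pair nu_eq)
    qed (simp add: Pair nu_eq differential_eq)
  qed
qed

lemma differential_point_mult:
  assumes "a \<in> arcs D"
  shows "differential D (point_mult D a x) = point_mult D a (differential D x)"
proof
  fix S show "differential D (point_mult D a x) S = point_mult D a (differential D x) S"
  proof (cases S)
    case (Pair P Q)
    show ?thesis
    proof (cases "(P, Q) \<in> enh_states D")
      case True
      let ?K = "circles D P" and ?K' = "\<lambda>c. circles D (insert c P)"
      let ?k = "base_circle D a P" and ?k' = "\<lambda>c. base_circle D a (insert c P)"
      have PQ: "P \<subseteq> crossings D" "Q \<subseteq> ?K"
        using True by (auto simp: enh_states_def)
      \<comment> \<open>A circle of both states that contains \<open>a\<close> is the base circle of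
        each. So the base circles agree, or neither is a circle of the other state.\<close>
      have k: "?k' c = ?k \<or> ?k' c \<notin> ?K \<and> ?k \<notin> ?K' c" for c
        using base_circle[OF assms] by metis
      have "differential D (point_mult D a x) (P, Q) = (\<Sum>c \<in> crossings D - P.
          edge_map (?K' c) ?K (raise (?k' c) (\<lambda>R. x (insert c P, R))) Q)"
        using PQ True
        by (auto simp: differential_eq point_mult_eq enh_states_def intro!: sum.cong edge_map_cong)
      also have "\<dots> = (\<Sum>c \<in> crossings D - P.
          raise ?k (edge_map (?K' c) ?K (\<lambda>R. x (insert c P, R))) Q)"
        using PQ by (intro sum.cong refl edge_map_raise finite_circles finite_arcs k base_circle assms)
      also have "\<dots> = raise ?k (\<lambda>R. differential D x (P, R)) Q"
        using PQ unfolding raise_sum[symmetric]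
        by (intro raise_cong) (auto simp: differential_eq enh_states_def)
      finally show ?thesis
        using True by (simp add: Pair point_mult_eq)
    qed (simp add: Pair point_mult_eq differential_eq)
  qed
qed

text \<open>Changing one + to - keeps the markers and lowers \<open>tau\<close> by 2. The dividend
  in \<open>j_deg\<close> drops by 4, so \<open>j_deg\<close> grows by 2.\<close>

lemma nu_carrier:
  assumes "x \<in> carrier (chain_space D i j)"
  shows "nu D x \<in> carrier (chain_space D i (j + 2))"
proof -
  have "(P, Q) \<in> enh_states D \<and> i_deg D (P, Q) = i \<and> j_deg D (P, Q) = j + 2"
    if nz: "nu D x (P, Q) \<noteq> 0" for P Q
  proof -
    have PQ: "(P, Q) \<in> enh_states D"
      using nz by (auto simp: nu_eq split: if_splits)
    then have "lower (circles D P) (\<lambda>R. x (P, R)) Q \<noteq> 0"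
      using nz by (simp add: nu_eq)
    \<comment> \<open>A nonzero sum has a nonzero summand, which provides an enhanced state of known
      bidegree one sign away.\<close>
    then obtain A where A: "A \<in> circles D P - Q" "x (P, insert A Q) \<noteq> 0"
      unfolding lower_def using sum.not_neutral_contains_not_neutral by blast
    then have deg: "i_deg D (P, insert A Q) = i" "j_deg D (P, insert A Q) = j"
      using assms by (auto simp: chain_space_def)
    have Q: "Q \<subseteq> circles D P" and fin: "finite (circles D P)"
      using PQ by (auto simp: enh_states_def finite_circles finite_arcs)
    have "circles D P - Q = insert A (circles D P - insert A Q)"
      using A by auto
    then have "card (circles D P - Q) = Suc (card (circles D P - insert A Q))"
      using fin by (metis Diff_iff card_insert_disjoint finite_Diff insertI1)
    moreover have "card (insert A Q) = Suc (card Q)"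
      using A Q fin by (meson DiffD2 card_insert_disjoint finite_subset)
    ultimately have "tau D (P, Q) = tau D (P, insert A Q) - 2"
      by (simp add: tau_def)
    then show ?thesis
      using PQ deg by (simp add: i_deg_def j_deg_def sigma_def)
  qed
  then show ?thesis
    by (auto simp: chain_space_def)
qed

lemma point_mult_carrier:
  assumes "a \<in> arcs D" "x \<in> carrier (chain_space D i j)"
  shows "point_mult D a x \<in> carrier (chain_space D i (j - 2))"
proof -
  have "(P, Q) \<in> enh_states D \<and> i_deg D (P, Q) = i \<and> j_deg D (P, Q) = j - 2"
    if nz: "point_mult D a x (P, Q) \<noteq> 0" for P Q
  proof -
    let ?A = "base_circle D a P"
    have PQ: "(P, Q) \<in> enh_states D" and A: "?A \<in> Q" "x (P, Q - {?A}) \<noteq> 0"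
      using nz by (auto simp: point_mult_eq raise_def split: if_splits)
    then have deg: "i_deg D (P, Q - {?A}) = i" "j_deg D (P, Q - {?A}) = j"
      using assms by (auto simp: chain_space_def)
    have Q: "Q \<subseteq> circles D P" and fin: "finite (circles D P)"
      using PQ by (auto simp: enh_states_def finite_circles finite_arcs)
    have "circles D P - (Q - {?A}) = insert ?A (circles D P - Q)"
      using A Q by auto
    then have "card (circles D P - (Q - {?A})) = Suc (card (circles D P - Q))"
      using A fin by simp
    moreover have "card Q = Suc (card (Q - {?A}))"
      using A Q fin by (meson card.remove finite_subset)
    ultimately have "tau D (P, Q) = tau D (P, Q - {?A}) + 2"
      by (simp add: tau_def)
    then show ?thesis
      using PQ deg by (simp add: i_deg_def j_deg_def sigma_def)
  qed
  then show ?thesis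
    by (auto simp: chain_space_def)
qed

end

section \<open>Homology\<close>

text \<open>One ambient module for all bidegrees: cycles and boundaries of every degree are
  submodules of it, and \<open>nu D\<close> is an endomorphism.\<close>

definition all_chains :: "(bit, ('c, 'a) chain) module" where
  "all_chains = \<lparr>carrier = UNIV, mult = undefined, one = undefined,
     zero = (\<lambda>S. 0), add = (\<lambda>x y S. x S + y S), smult = (\<lambda>a x S. a * x S)\<rparr>"

lemma chain_space_restrict: "(chain_space D i j)\<lparr>carrier := Z\<rparr> = all_chains\<lparr>carrier := Z\<rparr>"
  by (simp add: chain_space_def all_chains_def)

lemma chain_space_coset: "N +>\<^bsub>chain_space D i j\<^esub> x = N +>\<^bsub>all_chains\<^esub> x"
  by (simp add: a_r_coset_defs chain_space_def all_chains_def)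

lemma module_all_chains: "module class_ring (all_chains :: (bit, ('c, 'a) chain) module)"
proof (intro moduleI abelian_groupI)
  show "cring (class_ring :: bit ring)"
    by (intro domain.axioms(1) field.axioms(1) class_field)
  show "\<exists>y \<in> carrier all_chains. y \<oplus>\<^bsub>all_chains\<^esub> x = \<zero>\<^bsub>all_chains\<^esub>" for x :: "('c, 'a) chain"
    by (rule bexI[of _ x]) (auto simp: all_chains_def)
qed (auto simp: all_chains_def algebra_simps)

text \<open>The only scalars are 0 and 1, so closure under scalars amounts to containing
  zero.\<close>

lemma submodule_all_chains_iff:
  "LinearCombinations.submodule class_ring N all_chains \<longleftrightarrow>
    (\<lambda>S. 0) \<in> N \<and> (\<forall>x \<in> N. \<forall>y \<in> N. (\<lambda>S. x S + y S) \<in> N)"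
proof -
  have "(\<lambda>S. c * x S) \<in> N" if "(\<lambda>S. 0) \<in> N" "x \<in> N" for c x
    using that by (cases c) auto
  then show ?thesis
    using module_all_chains by (auto simp: LinearCombinations.submodule_def all_chains_def)
qed

text \<open>Additivity gives \<open>f\<close> of zero as a sum of two equal chains, hence zero; this
  settles the scalar 0, and 1 is trivial.\<close>

lemma additive_module_hom:
  assumes "\<And>x y. f (\<lambda>S. x S + y S) = (\<lambda>S. f x S + f y S)"
  shows "f \<in> LinearCombinations.module_hom class_ring all_chains all_chains"
proof -
  have "f (\<lambda>S. 0) = (\<lambda>S. 0)"
    using assms[of "\<lambda>S. 0" "\<lambda>S. 0"] by simp
  then have "f (\<lambda>S. c * x S) = (\<lambda>S. c * f x S)" for c x
    by (cases c) auto
  then show ?thesis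
    using assms by (auto simp: LinearCombinations.module_hom_def all_chains_def)
qed

section \<open>Cycles and boundaries as submodules\<close>

lemma differential_add: "differential D (\<lambda>S. x S + y S) = (\<lambda>S. differential D x S + differential D y S)"
  by (simp add: differential_def algebra_simps sum.distrib)

lemma nu_add: "nu D (\<lambda>S. x S + y S) = (\<lambda>S. nu D x S + nu D y S)"
  by (simp add: nu_def algebra_simps sum.distrib)

lemma differential_zero: "differential D (\<lambda>S. 0) = (\<lambda>S. 0)"
  by (simp add: differential_def)

lemma nu_zero: "nu D (\<lambda>S. 0) = (\<lambda>S. 0)"
  by (simp add: nu_def)

lemma submodule_chain_space:
  "LinearCombinations.submodule class_ring (carrier (chain_space D i j)) all_chains"
  unfolding submodule_all_chains_iff
proof (intro conjI ballI)
  fix x y assume xy: "x \<in> carrier (chain_space D i j)" "y \<in> carrier (chain_space D i j)"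
  have "x S \<noteq> 0 \<or> y S \<noteq> 0" if "x S + y S \<noteq> 0" for S
    using that by auto
  then show "(\<lambda>S. x S + y S) \<in> carrier (chain_space D i j)"
    using xy unfolding chain_space_def by simp blast
qed (simp add: chain_space_def)

lemma cycles_eq: "cycles D i j = {x \<in> carrier (chain_space D i j). differential D x = (\<lambda>S. 0)}"
  by (simp add: cycles_def chain_space_def)

lemma submodule_cycles: "LinearCombinations.submodule class_ring (cycles D i j) all_chains"
  using submodule_chain_space[of D i j] unfolding submodule_all_chains_iff
  by (auto simp: cycles_eq differential_add differential_zero)

lemma submodule_boundaries: "LinearCombinations.submodule class_ring (boundaries D i j) all_chains"
  using submodule_chain_space[of D "i - 1" j] unfolding submodule_all_chains_iff boundaries_def
  by (auto simp flip: differential_add simp: image_iff intro: differential_zero[symmetric])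

section \<open>Exactness and Betti numbers of the homology\<close>

context finite_diagram
begin

lemma nu_bar_exact:
  assumes a: "a \<in> arcs D"
  shows "exact_at class_ring
    (homology D i (j - 2)) (nu_bar D i (j - 2)) (homology D i j) (nu_bar D i j) (homology D i (j + 2))"
proof -
  \<comment> \<open>\<open>nu\<close> and \<open>point_mult\<close> commute with the differential,
    hence preserve cycles and boundaries, shifting \<open>j\<close> by 2 and by -2.\<close>
  have nu_cycles: "nu D ` cycles D i j' \<subseteq> cycles D i (j' + 2)" for j'
    using nu_carrier by (auto simp: cycles_eq differential_nu nu_zero)
  have nu_boundaries: "nu D ` boundaries D i j' \<subseteq> boundaries D i (j' + 2)" for j'
    using nu_carrier by (auto simp: boundaries_def differential_nu[symmetric])
  have zero: "point_mult D a (\<lambda>S. 0) = (\<lambda>S. 0)"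
    by (auto simp: point_mult_def raise_def)
  have point_cycles: "point_mult D a ` cycles D i j' \<subseteq> cycles D i (j' - 2)" for j'
    using point_mult_carrier[OF a] by (auto simp: cycles_eq differential_point_mult[OF a] zero)
  have point_boundaries: "point_mult D a ` boundaries D i j' \<subseteq> boundaries D i (j' - 2)" for j'
    using point_mult_carrier[OF a] by (auto simp: boundaries_def differential_point_mult[OF a, symmetric])
  have homotopy: "point_mult D a (nu D x) \<oplus>\<^bsub>all_chains\<^esub> nu D (point_mult D a x) = x"
    if "x \<in> cycles D i j" for x
  proof -
    have "x S = 0" if "S \<notin> enh_states D" for S
      using that \<open>x \<in> cycles D i j\<close> by (cases S) (auto simp: cycles_eq chain_space_def)
    from nu_point_mult[OF a this] show ?thesis
      by (auto simp: all_chains_def add.commute)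
  qed
  have "nu_bar D i (j - 2) = (\<lambda>X. the_elem ((\<lambda>x. boundaries D i j +>\<^bsub>all_chains\<^esub> nu D x) ` X))"
    "nu_bar D i j = (\<lambda>X. the_elem ((\<lambda>x. boundaries D i (j + 2) +>\<^bsub>all_chains\<^esub> nu D x) ` X))"
    by (auto simp: nu_bar_def chain_space_coset)
  moreover have "homology D i j' =
      quotient_module (all_chains\<lparr>carrier := cycles D i j'\<rparr>) (boundaries D i j')" for j'
    by (simp add: homology_def chain_space_restrict)
  moreover have "nu D (nu D x) = \<zero>\<^bsub>all_chains\<^esub>" for x
    by (simp add: nu_nu all_chains_def)
  ultimately show ?thesis
    \<comment> \<open>The homotopy is applied to cycles of degree \<open>j\<close> and to boundaries
      of degree \<open>j + 2\<close>.\<close>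
    using nu_cycles[of "j - 2"] nu_cycles[of j] nu_boundaries[of "j - 2"] nu_boundaries[of j]
      point_cycles[of j] point_boundaries[of "j + 2"]
    by (auto intro!: module.exact_at_quotient_modules[OF module_all_chains, where h = "point_mult D a"]
        class_field additive_module_hom nu_add submodule_cycles submodule_boundaries homotopy)
qed

text \<open>Chains are functions into a two-element field supported on the finite set of enhanced
  states. This gives the finite dimension that rank-nullity requires.\<close>

lemma finite_homology: "finite (carrier (homology D i j))"
proof -
  have "carrier (chain_space D i j) \<subseteq> {x. \<forall>S. S \<notin> enh_states D \<longrightarrow> x S = 0}"
    by (auto simp: chain_space_def)
  moreover have "finite {x :: _ \<Rightarrow> bit. \<forall>S. S \<notin> enh_states D \<longrightarrow> x S = 0}"
  proof -
    have "(UNIV :: bit set) \<subseteq> {0, 1}"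
      using bit.exhaust by blast
    then have "finite (UNIV :: bit set)"
      by (rule finite_subset) simp
    then show ?thesis
      using finite_set_of_finite_funs[OF finite_enh_states[OF finite_crossings finite_arcs], of UNIV 0]
      by simp
  qed
  ultimately have "finite (cycles D i j)"
    unfolding cycles_eq by (auto intro: finite_subset)
  then show ?thesis
    by (simp add: homology_def quotient_module_def A_RCOSETS_defs)
qed

text \<open>\<open>nu_bar\<close> moves \<open>j\<close> by 2, so the degrees
  \<open>2 * j + g\<close> form one exact sequence indexed by consecutive integers.\<close>

lemma alternating_sum_betti:
  assumes "arcs D \<noteq> {}"
  shows "Sum_any (\<lambda>j :: int. (- 1) ^ nat \<bar>j\<bar> * int (betti D i (2 * j + g))) = 0"
proof -
  from assms obtain a where a: "a \<in> arcs D"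
    by auto
  \<comment> \<open>The finite support of the Betti numbers is pulled back along an injective
    map.\<close>
  have fin: "finite ((\<lambda>j :: int. 2 * j + g) -` {j. betti D i j \<noteq> 0})"
    by (intro finite_vimageI finite_betti_support finite_crossings finite_arcs) (auto intro: injI)
  show ?thesis
    unfolding betti_def
  proof (rule alternating_sum_dim_exact_sequence[where f = "\<lambda>j. nu_bar D i (2 * j + g)"])
    fix j :: int
    have "2 * (j - 1) + g = 2 * j + g - 2" "2 * (j + 1) + g = 2 * j + g + 2"
      by auto
    then show "exact_at class_ring (homology D i (2 * (j - 1) + g)) (nu_bar D i (2 * (j - 1) + g))
        (homology D i (2 * j + g)) (nu_bar D i (2 * j + g)) (homology D i (2 * (j + 1) + g))"
      using nu_bar_exact[OF a, of i "2 * j + g"] by (simp only:)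
  qed (use fin finite_homology in \<open>auto simp: betti_def vimage_def\<close>)
qed

end

theorem mainTheorem6:
  fixes D :: "('c, 'a) diagram"
  assumes "planar_link_diagram D"
  shows "(\<forall>i j. exact_at class_ring
            (homology D i (j - 2)) (nu_bar D i (j - 2))
            (homology D i j) (nu_bar D i j)
            (homology D i (j + 2))) \<and>
         (\<forall>i. Sum_any (\<lambda>j :: int. (-1) ^ nat \<bar>j\<bar> *
            int (betti D i (2 * j + int (card (link_components D) mod 2)))) = 0)"
proof -
  interpret finite_diagram D
    using assms by unfold_locales (auto simp: planar_link_diagram_def)
  have arcs: "arcs D \<noteq> {}"
    using assms by (simp add: planar_link_diagram_def)
  \<comment> \<open>Any arc serves as the base point of the homotopy.\<close>
  then obtain a where "a \<in> arcs D"
    by auto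
  then show ?thesis
    using nu_bar_exact alternating_sum_betti[OF arcs] by blast
qed

end
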